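(* Let $A$ be a non-empty closed subset of $E^{n}$. If every pair of boundary points of $A$ is hyperbolic, then $A$ is strictly convex.
   Context: $E^{n}$ is the $n$-dimensional Euclidean space, $n\ge 1$. For $A\subset E^n$, $\mathrm{int}(A)$ and $\partial A$ denote the interior and boundary of $A$. For points $p,q$, $[pq]$ is the closed segment joining them and $(pq)=[pq]\setminus\{p,q\}$ is the open segment. A pair of distinct boundary points $p,q\in\partial A$ is called hyperbolic if $(pq)\subset \mathrm{int}(A)$; "every pair of boundary points" means every pair of distinct points of $\partial A$. Strictly convex has its standard meaning: a closed set $A$ is strictly convex if for all distinct $x,y\in A$ the open segment $(xy)$ is contained in $\mathrm{int}(A)$. *)

theory Defs
  imports "HOL-Analysis.Analysis"
begin

definition hyperbolic_pair :: "'a::euclidean_space set \<Rightarrow> 'a \<Rightarrow> 'a \<Rightarrow> bool" where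
  "hyperbolic_pair A p q \<longleftrightarrow>
     p \<in> frontier A \<and> q \<in> frontier A \<and> p \<noteq> q \<and> open_segment p q \<subseteq> interior A"

text \<open>Intended for closed sets only; closedness is a separate assumption where it is used.\<close>

definition strictly_convex :: "'a::euclidean_space set \<Rightarrow> bool" where
  "strictly_convex A \<longleftrightarrow>
     (\<forall>x\<in>A. \<forall>y\<in>A. x \<noteq> y \<longrightarrow> open_segment x y \<subseteq> interior A)"

end

theory Submission
  imports Defs
begin

text \<open>
  A point \<open>z\<close> outside \<open>A\<close> on a segment between two points of \<open>A\<close> would lie strictly between the
  boundary points met when moving from \<open>z\<close> towards either end, and hyperbolicity would put it
  in the interior. Hence \<open>A\<close> is convex, so an open segment with an interior endpoint lies in the
  interior; if neither endpoint is interior, both are boundary points and hyperbolicity applies.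
\<close>

text \<open>The ends are pulled in one at a time: transitivity of betweenness first replaces
  \<open>x\<close> by \<open>p\<close>, then \<open>y\<close> by \<open>q\<close>.\<close>

lemma between_shrink:
  fixes x y z p q :: "'a::euclidean_space"
  assumes "z \<in> closed_segment x y" "p \<in> closed_segment z x" "q \<in> closed_segment z y"
  shows "z \<in> closed_segment p q"
proof -
  have zy: "between (p, y) z"
    using assms(1,2) by (metis between_commute between_mem_segment between_trans_2)
  then show ?thesis
    using assms(3) by (metis between_commute between_mem_segment between_trans_2)
qed

lemma convex_if_hyperbolic_pairs:
  fixes A :: "'a::euclidean_space set"
  assumes "closed A"
    and hyp: "\<And>p q. p \<in> frontier A \<Longrightarrow> q \<in> frontier A \<Longrightarrow> p \<noteq> q \<Longrightarrow> hyperbolic_pair A p q"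
  shows "convex A"
proof -
  have "z \<in> A" if "x \<in> A" "y \<in> A" "z \<in> closed_segment x y" for x y z
  proof (rule ccontr)
    assume "z \<notin> A"
    \<comment> \<open>The segment is connected and has one end in \<open>A\<close> and the other
      outside, so it crosses the frontier.\<close>
    have frontier_point: "\<exists>p \<in> closed_segment z u. p \<in> frontier A" if "u \<in> A" for u
    proof -
      have "closed_segment z u \<inter> A \<noteq> {}"
        using that ends_in_segment(2) by blast
      moreover have "closed_segment z u - A \<noteq> {}"
        using \<open>z \<notin> A\<close> ends_in_segment(1) by blast
      ultimately have "closed_segment z u \<inter> frontier A \<noteq> {}"
        by (intro connected_Int_frontier connected_segment)
      then show ?thesis by blast
    qed
    obtain p q where p: "p \<in> closed_segment z x" "p \<in> frontier A"
      and q: "q \<in> closed_segment z y" "q \<in> frontier A"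
      using frontier_point [OF \<open>x \<in> A\<close>] frontier_point [OF \<open>y \<in> A\<close>] by blast
    \<comment> \<open>Closedness puts \<open>p\<close> and \<open>q\<close> in \<open>A\<close>,
      unlike \<open>z\<close>. This also excludes \<open>p = q\<close>, since a degenerate segment
      through \<open>z\<close> would be just \<open>z\<close>.\<close>
    have "z \<noteq> p" "z \<noteq> q"
      using p q \<open>z \<notin> A\<close> frontier_subset_closed [OF \<open>closed A\<close>] by auto
    moreover have "z \<in> closed_segment p q"
      using between_shrink that(3) p(1) q(1) by blast
    ultimately have "z \<in> open_segment p q" "p \<noteq> q"
      by (auto simp: open_segment_def)
    then have "z \<in> interior A"
      using hyp [OF p(2) q(2)] by (auto simp: hyperbolic_pair_def)
    then show False
      using \<open>z \<notin> A\<close> interior_subset by blast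
  qed
  then show ?thesis
    unfolding convex_contains_segment by blast
qed

theorem theorem4:
  fixes A :: "(real ^ 'n) set"
  assumes "A \<noteq> {}"
    and "closed A"
    and "\<And>p q. p \<in> frontier A \<Longrightarrow> q \<in> frontier A \<Longrightarrow> p \<noteq> q \<Longrightarrow> hyperbolic_pair A p q"
  shows "strictly_convex A"
  unfolding strictly_convex_def
proof (intro ballI impI)
  fix x y
  assume xy: "x \<in> A" "y \<in> A" "x \<noteq> y"
  have "convex A"
    using assms(2,3) by (rule convex_if_hyperbolic_pairs)
  \<comment> \<open>By convexity, a ball in \<open>A\<close> around \<open>u\<close>, contracted
    towards \<open>v\<close>, stays in \<open>A\<close> and surrounds each point of the open
    segment.\<close>
  have interior_endpoint: "open_segment u v \<subseteq> interior A" if "u \<in> interior A" "v \<in> A" for u v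
    using in_interior_closure_convex_segment [OF \<open>convex A\<close> that(1)] that(2) closure_subset [of A] by blast
  consider "x \<in> interior A" | "y \<in> interior A" | "x \<in> frontier A" "y \<in> frontier A"
    using xy closure_subset [of A] unfolding frontier_def by blast
  then show "open_segment x y \<subseteq> interior A"
  proof cases
    case 1
    then show ?thesis using interior_endpoint xy by blast
  next
    case 2
    then show ?thesis using interior_endpoint [of y x] xy by (simp add: open_segment_commute)
  next
    case 3
    then show ?thesis using assms(3) xy by (auto simp: hyperbolic_pair_def)
  qed
qed

end
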